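(* Let $(X,d)$ be a metric space and let $\mathfrak B$ be a bornology with closed base on $X$ such that $X\notin\mathfrak B$ and $X$ is $\mathfrak B^s$-Lindelöf. The following assertions are equivalent: (1) $(\mathsf C(X),\tau_{\mathfrak B}^s)$ is a Fréchet-Urysohn space; (2) $(\mathsf C(X),\tau_{\mathfrak B}^s)$ is a strictly Fréchet-Urysohn space; (3) each $\mathfrak B^s$-cover $\mathcal U$ of $X$ contains a countable set $\{U_n:n\in\mathbb N\}$ which is a $\gamma_{\mathfrak B^s}$-cover of $X$; (4) $X$ satisfies $\mathsf S_1(\mathcal O_{\mathfrak B^s},\Gamma_{\mathfrak B^s})$.
   Context: A bornology on a metric space $(X,d)$ is a family $\mathfrak B$ of nonempty subsets of $X$ that is closed under finite unions, closed under taking nonempty subsets, and covers $X$. A base for $\mathfrak B$ is a subfamily $\mathfrak B_0\subset\mathfrak B$ such that every $B\in\mathfrak B$ is contained in some $B_0\in\mathfrak B_0$; it is a closed base if all its members are closed in $X$. For $A\subset X$ and $\varepsilon>0$, $A^{\varepsilon}=\bigcup_{a\in A}\{y\in X: d(a,y)<\varepsilon\}$. $\mathsf C(X)$ is the set of all continuous functions $X\to\mathbb R$. The topology $\tau_{\mathfrak B}^s$ of strong uniform convergence on $\mathfrak B$ is the topology on $\mathsf C(X)$ in which each $f$ has as a local base the sets $[B,\varepsilon]^s(f)=\{g\in\mathsf C(X):\exists\delta>0\ \forall x\in B^{\delta}\ |g(x)-f(x)|<\varepsilon\}$, for $B\in\mathfrak B$ and $\varepsilon>0$. A strong $\mathfrak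 B$-cover ($\mathfrak B^s$-cover) of $X$ is an open cover $\mathcal U$ of $X$ such that $X\notin\mathcal U$ and for each $B\in\mathfrak B$ there are $U\in\mathcal U$ and $\delta>0$ with $B^{\delta}\subset U$. $\mathcal O_{\mathfrak B^s}$ is the collection of all $\mathfrak B^s$-covers of $X$. $X$ is $\mathfrak B^s$-Lindelöf if every $\mathfrak B^s$-cover of $X$ contains a countable subfamily that is a $\mathfrak B^s$-cover. A countable open cover $\mathcal U=\{U_n:n\in\mathbb N\}$ of $X$ is a $\gamma_{\mathfrak B^s}$-cover if it is infinite and for each $B\in\mathfrak B$ there are $n_0\in\mathbb N$ and a sequence $(\delta_n:n\ge n_0)$ of positive reals such that $B^{\delta_n}\subset U_n$ for all $n\ge n_0$. $\Gamma_{\mathfrak B^s}$ is the collection of all $\gamma_{\mathfrak B^s}$-covers of $X$. For families $\mathfrak U,\mathfrak V$, $\mathsf S_1(\mathfrak U,\mathfrak V)$ is the statement: for each sequence $(U_n:n\in\mathbb N)$ of elements of $\mathfrak U$ there is a sequence $(u_n:n\in\mathbb N)$ with $u_n\in U_n$ for each $n$ and $\{u_n:n\in\mathbb N\}\in\mathfrak V$. A topological space $Z$ is Fréchet-Urysohn if for each $A\subset Z$ and each $z\in\overline A$ there is a sequence in $A$ converging to $z$. For $z\in Z$, $\Omega_z=\{A\subset Z\setminus\{z\}: z\in\overline A\}$ and $\Sigma_z$ is the set of sequences converging to $z$. $Z$ is strictly Fréchet-Urysohn if $\mathsf S_1(\Omega_z,\Sigma_z)$ holds for each $z\in Z$, i.e.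 for each sequence $(A_n:n\in\mathbb N)$ of elements of $\Omega_z$ there are $a_n\in A_n$ such that the sequence $(a_n:n\in\mathbb N)$ converges to $z$. *)

theory Defs
  imports "HOL-Analysis.Analysis"
begin

text \<open>The metric space \<open>X\<close> is a type of class \<open>metric_space\<close>, so the set \<open>X\<close> is \<open>UNIV\<close>.\<close>

definition bornology :: "'a set set \<Rightarrow> bool" where
  "bornology \<BB> \<longleftrightarrow>
     {} \<notin> \<BB> \<and>
     (\<forall>F. finite F \<and> F \<noteq> {} \<and> F \<subseteq> \<BB> \<longrightarrow> \<Union>F \<in> \<BB>) \<and>
     (\<forall>B\<in>\<BB>. \<forall>A. A \<noteq> {} \<and> A \<subseteq> B \<longrightarrow> A \<in> \<BB>) \<and>
     \<Union>\<BB> = UNIV"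

definition bornology_base :: "'a set set \<Rightarrow> 'a set set \<Rightarrow> bool" where
  "bornology_base \<BB>\<^sub>0 \<BB> \<longleftrightarrow> \<BB>\<^sub>0 \<subseteq> \<BB> \<and> (\<forall>B\<in>\<BB>. \<exists>B\<^sub>0\<in>\<BB>\<^sub>0. B \<subseteq> B\<^sub>0)"

definition has_closed_base :: "'a::topological_space set set \<Rightarrow> bool" where
  "has_closed_base \<BB> \<longleftrightarrow> (\<exists>\<BB>\<^sub>0. bornology_base \<BB>\<^sub>0 \<BB> \<and> (\<forall>B\<in>\<BB>\<^sub>0. closed B))"

definition enlargement :: "'a::metric_space set \<Rightarrow> real \<Rightarrow> 'a set" where
  "enlargement A \<epsilon> = (\<Union>a\<in>A. ball a \<epsilon>)"

definition cont_funs :: "('a::topological_space \<Rightarrow> real) set" where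
  "cont_funs = {f. continuous_on UNIV f}"

definition strong_nbhd :: "'a::metric_space set \<Rightarrow> real \<Rightarrow> ('a \<Rightarrow> real) \<Rightarrow> ('a \<Rightarrow> real) set" where
  "strong_nbhd B \<epsilon> f =
     {g \<in> cont_funs. \<exists>\<delta>>0. \<forall>x\<in>enlargement B \<delta>. \<bar>g x - f x\<bar> < \<epsilon>}"

text \<open>The open sets are those containing a basic neighbourhood of each of their points.
  For a bornology this is a topology, and the sets \<open>strong_nbhd B \<epsilon> f\<close> form a local
  base at \<open>f\<close>; both facts are proved below.\<close>

definition strong_topology :: "'a::metric_space set set \<Rightarrow> ('a \<Rightarrow> real) topology" where
  "strong_topology \<BB> = topology (\<lambda>W. W \<subseteq> cont_funs \<and>
     (\<forall>f\<in>W. \<exists>B\<in>\<BB>. \<exists>\<epsilon>>0. strong_nbhd B \<epsilon> f \<subseteq> W))"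

definition strong_cover :: "'a::metric_space set set \<Rightarrow> 'a set set \<Rightarrow> bool" where
  "strong_cover \<BB> \<U> \<longleftrightarrow>
     (\<forall>U\<in>\<U>. open U) \<and> \<Union>\<U> = UNIV \<and> UNIV \<notin> \<U> \<and>
     (\<forall>B\<in>\<BB>. \<exists>U\<in>\<U>. \<exists>\<delta>>0. enlargement B \<delta> \<subseteq> U)"

definition strong_covers :: "'a::metric_space set set \<Rightarrow> 'a set set set" where
  "strong_covers \<BB> = {\<U>. strong_cover \<BB> \<U>}"

definition strong_Lindelof :: "'a::metric_space set set \<Rightarrow> bool" where
  "strong_Lindelof \<BB> \<longleftrightarrow>
     (\<forall>\<U>\<in>strong_covers \<BB>. \<exists>\<V>\<subseteq>\<U>. countable \<V> \<and> \<V> \<in> strong_covers \<BB>)"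

text \<open>A countable cover is a set of sets; the enumeration \<open>u\<close> witnesses \<open>\<U> = {U\<^sub>n : n \<in> \<nat>}\<close>.
  As \<open>\<U>\<close> is infinite, the tail condition says that for each \<open>B\<close> all but finitely many members
  contain some enlargement of \<open>B\<close>.\<close>

definition gamma_cover :: "'a::metric_space set set \<Rightarrow> 'a set set \<Rightarrow> bool" where
  "gamma_cover \<BB> \<U> \<longleftrightarrow>
     (\<forall>U\<in>\<U>. open U) \<and> \<Union>\<U> = UNIV \<and> infinite \<U> \<and>
     (\<exists>u :: nat \<Rightarrow> 'a set. \<U> = range u \<and>
       (\<forall>B\<in>\<BB>. \<exists>n\<^sub>0. \<exists>\<delta> :: nat \<Rightarrow> real. \<forall>n\<ge>n\<^sub>0. \<delta> n > 0 \<and> enlargement B (\<delta> n) \<subseteq> u n))"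

definition gamma_covers :: "'a::metric_space set set \<Rightarrow> 'a set set set" where
  "gamma_covers \<BB> = {\<U>. gamma_cover \<BB> \<U>}"

text \<open>The selection principle \<open>S\<^sub>1\<close>, for a target family of sets (the selected elements
  are collected into a set) and for a target family of sequences.\<close>

definition S1_seq :: "'b set set \<Rightarrow> (nat \<Rightarrow> 'b) set \<Rightarrow> bool" where
  "S1_seq \<A> \<S> \<longleftrightarrow>
     (\<forall>U :: nat \<Rightarrow> 'b set. (\<forall>n. U n \<in> \<A>) \<longrightarrow> (\<exists>u. (\<forall>n. u n \<in> U n) \<and> u \<in> \<S>))"

definition S1 :: "'b set set \<Rightarrow> 'b set set \<Rightarrow> bool" where
  "S1 \<A> \<V> \<longleftrightarrow>
     (\<forall>U :: nat \<Rightarrow> 'b set. (\<forall>n. U n \<in> \<A>) \<longrightarrow> (\<exists>u. (\<forall>n. u n \<in> U n) \<and> range u \<in> \<V>))"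

definition Frechet_Urysohn :: "'b topology \<Rightarrow> bool" where
  "Frechet_Urysohn Z \<longleftrightarrow>
     (\<forall>A\<subseteq>topspace Z. \<forall>z\<in>Z closure_of A.
        \<exists>a :: nat \<Rightarrow> 'b. range a \<subseteq> A \<and> limitin Z a z sequentially)"

definition Omega_at :: "'b topology \<Rightarrow> 'b \<Rightarrow> 'b set set" where
  "Omega_at Z z = {A. A \<subseteq> topspace Z - {z} \<and> z \<in> Z closure_of A}"

definition Sigma_at :: "'b topology \<Rightarrow> 'b \<Rightarrow> (nat \<Rightarrow> 'b) set" where
  "Sigma_at Z z = {a. range a \<subseteq> topspace Z \<and> limitin Z a z sequentially}"

definition strictly_Frechet_Urysohn :: "'b topology \<Rightarrow> bool" where
  "strictly_Frechet_Urysohn Z \<longleftrightarrow> (\<forall>z\<in>topspace Z. S1_seq (Omega_at Z z) (Sigma_at Z z))"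

lemma bornology_Un:
  assumes "bornology \<BB>" "A \<in> \<BB>" "B \<in> \<BB>"
  shows "A \<union> B \<in> \<BB>"
proof -
  have "\<Union>{A, B} \<in> \<BB>"
    using assms unfolding bornology_def by (metis empty_not_insert empty_subsetI
        finite.emptyI finite.insertI insert_subset)
  then show ?thesis by simp
qed

lemma bornology_nonempty: "bornology \<BB> \<Longrightarrow> \<BB> \<noteq> {}"
  unfolding bornology_def by auto

lemma enlargement_mono:
  "A \<subseteq> B \<Longrightarrow> \<delta> \<le> \<epsilon> \<Longrightarrow> enlargement A \<delta> \<subseteq> enlargement B \<epsilon>"
  unfolding enlargement_def by fastforce

lemma strong_nbhd_mono:
  assumes "A \<subseteq> B" "\<delta> \<le> \<epsilon>"
  shows "strong_nbhd B \<delta> f \<subseteq> strong_nbhd A \<epsilon> f"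
proof
  fix g assume "g \<in> strong_nbhd B \<delta> f"
  then obtain e where "g \<in> cont_funs" "e > 0" "\<forall>x\<in>enlargement B e. \<bar>g x - f x\<bar> < \<delta>"
    unfolding strong_nbhd_def by auto
  moreover have "enlargement A e \<subseteq> enlargement B e"
    using assms by (intro enlargement_mono) auto
  ultimately show "g \<in> strong_nbhd A \<epsilon> f"
    using assms(2) unfolding strong_nbhd_def by fastforce
qed

lemma istopology_strong:
  assumes "bornology \<BB>"
  shows "istopology (\<lambda>W. W \<subseteq> cont_funs \<and>
     (\<forall>f\<in>W. \<exists>B\<in>\<BB>. \<exists>\<epsilon>>0. strong_nbhd B \<epsilon> f \<subseteq> W))"
  unfolding istopology_def
proof (intro conjI allI impI ballI)
  fix S T f
  assume S: "S \<subseteq> cont_funs \<and> (\<forall>f\<in>S. \<exists>B\<in>\<BB>. \<exists>\<epsilon>>0. strong_nbhd B \<epsilon> f \<subseteq> S)"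
    and T: "T \<subseteq> cont_funs \<and> (\<forall>f\<in>T. \<exists>B\<in>\<BB>. \<exists>\<epsilon>>0. strong_nbhd B \<epsilon> f \<subseteq> T)"
  show "S \<inter> T \<subseteq> cont_funs" using S by auto
  assume f: "f \<in> S \<inter> T"
  obtain B d where 1: "B \<in> \<BB>" "d > 0" "strong_nbhd B d f \<subseteq> S" using S f by blast
  obtain C e where 2: "C \<in> \<BB>" "e > 0" "strong_nbhd C e f \<subseteq> T" using T f by blast
  have "strong_nbhd (B \<union> C) (min d e) f \<subseteq> strong_nbhd B d f"
    "strong_nbhd (B \<union> C) (min d e) f \<subseteq> strong_nbhd C e f"
    by (intro strong_nbhd_mono; simp)+
  moreover have "B \<union> C \<in> \<BB>" using bornology_Un assms 1 2 by blast
  moreover have "min d e > 0" using 1 2 by simp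
  ultimately show "\<exists>B\<in>\<BB>. \<exists>\<epsilon>>0. strong_nbhd B \<epsilon> f \<subseteq> S \<inter> T"
    using 1 2 by (meson Int_greatest order_trans)
next
  fix K f
  assume K: "\<forall>S\<in>K. S \<subseteq> cont_funs \<and> (\<forall>f\<in>S. \<exists>B\<in>\<BB>. \<exists>\<epsilon>>0. strong_nbhd B \<epsilon> f \<subseteq> S)"
  show "\<Union>K \<subseteq> cont_funs" using K by blast
  assume "f \<in> \<Union>K"
  then obtain S where S: "S \<in> K" "f \<in> S" by blast
  then obtain B e where "B \<in> \<BB>" "e > 0" "strong_nbhd B e f \<subseteq> S" using K by blast
  then show "\<exists>B\<in>\<BB>. \<exists>\<epsilon>>0. strong_nbhd B \<epsilon> f \<subseteq> \<Union>K" using S by blast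
qed

lemma openin_strong_topology:
  assumes "bornology \<BB>"
  shows "openin (strong_topology \<BB>) W \<longleftrightarrow>
     W \<subseteq> cont_funs \<and> (\<forall>f\<in>W. \<exists>B\<in>\<BB>. \<exists>\<epsilon>>0. strong_nbhd B \<epsilon> f \<subseteq> W)"
  unfolding strong_topology_def using istopology_strong[OF assms] by simp

lemma topspace_strong_topology:
  assumes "bornology \<BB>"
  shows "topspace (strong_topology \<BB>) = cont_funs"
proof -
  obtain B where B: "B \<in> \<BB>" using bornology_nonempty[OF assms] by blast
  have "strong_nbhd B 1 f \<subseteq> cont_funs" for f unfolding strong_nbhd_def by blast
  then have "openin (strong_topology \<BB>) cont_funs"
    unfolding openin_strong_topology[OF assms] using B by (meson order_refl zero_less_one)
  then show ?thesis
    using openin_strong_topology[OF assms] openin_topspace by (metis openin_subset subset_antisym)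
qed

lemma strong_nbhd_local_base:
  assumes "bornology \<BB>" "B \<in> \<BB>" "\<epsilon> > 0" "f \<in> cont_funs"
  shows "\<exists>W. openin (strong_topology \<BB>) W \<and> f \<in> W \<and> W \<subseteq> strong_nbhd B \<epsilon> f"
proof (intro exI conjI)
  define W where "W = (\<Union>\<eta>\<in>{0<..<\<epsilon>}. strong_nbhd B \<eta> f)"
  show "W \<subseteq> strong_nbhd B \<epsilon> f"
    unfolding W_def by (intro UN_least strong_nbhd_mono) auto
  have "f \<in> strong_nbhd B (\<epsilon>/2) f"
    unfolding strong_nbhd_def using assms by (auto intro: exI[of _ 1])
  then show "f \<in> W" unfolding W_def using assms(3) by (auto intro!: bexI[of _ "\<epsilon>/2"])
  show "openin (strong_topology \<BB>) W"
    unfolding openin_strong_topology[OF assms(1)]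
  proof (intro conjI ballI)
    show "W \<subseteq> cont_funs" unfolding W_def strong_nbhd_def by auto
    fix g assume "g \<in> W"
    then obtain \<eta> d where h: "0 < \<eta>" "\<eta> < \<epsilon>" "d > 0" "\<forall>x\<in>enlargement B d. \<bar>g x - f x\<bar> < \<eta>"
      unfolding W_def strong_nbhd_def by auto
    define \<zeta> where "\<zeta> = (\<epsilon> - \<eta>) / 2"
    have z: "\<zeta> > 0" "\<eta> + \<zeta> < \<epsilon>" using h by (auto simp: \<zeta>_def field_simps)
    have "strong_nbhd B \<zeta> g \<subseteq> strong_nbhd B (\<eta> + \<zeta>) f"
    proof
      fix k assume "k \<in> strong_nbhd B \<zeta> g"
      then obtain e where k: "k \<in> cont_funs" "e > 0" "\<forall>x\<in>enlargement B e. \<bar>k x - g x\<bar> < \<zeta>"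
        unfolding strong_nbhd_def by auto
      have "\<bar>k x - f x\<bar> < \<eta> + \<zeta>" if "x \<in> enlargement B (min d e)" for x
      proof -
        have "x \<in> enlargement B d" "x \<in> enlargement B e"
          using that enlargement_mono[of B B "min d e" d] enlargement_mono[of B B "min d e" e]
          by auto
        then have "\<bar>g x - f x\<bar> < \<eta>" "\<bar>k x - g x\<bar> < \<zeta>" using h k by auto
        then show ?thesis by linarith
      qed
      then show "k \<in> strong_nbhd B (\<eta> + \<zeta>) f"
        unfolding strong_nbhd_def using k h by (auto intro!: exI[of _ "min d e"])
    qed
    also have "\<dots> \<subseteq> W" unfolding W_def using h z by (intro UN_upper) auto
    finally show "\<exists>B\<in>\<BB>. \<exists>\<epsilon>>0. strong_nbhd B \<epsilon> g \<subseteq> W" using assms(2) z by blast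
  qed
qed

end

theory Submission
  imports Defs
begin

text \<open>The core is the Gerlits--Nagy argument, which yields from (3) the sequential form of (4):
  the selected members \<open>u n\<close> satisfy, for each \<open>B\<close>, that \<open>u n\<close> contains an enlargement of \<open>B\<close>
  for all large \<open>n\<close>. Given strong covers \<open>U\<^sub>n\<close>, take a \<open>\<gamma>\<close>-cover \<open>{S\<^sub>n}\<close> inside \<open>U\<^sub>0\<close> and apply (3)
  to the cover of all sets \<open>S\<^sub>n \<inter> V\<^sub>0 \<inter> \<dots> \<inter> V\<^sub>n\<close> with \<open>V\<^sub>i \<in> U\<^sub>i\<close>. Since each \<open>S\<^sub>n\<close> omits a point, the
  indices \<open>n\<close> occurring in the resulting \<open>\<gamma>\<close>-cover are unbounded, so that its members have an
  \<open>i\<close>-th factor in \<open>U\<^sub>i\<close> arbitrarily far out. The sequential form gives (2) through the sets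
  \<open>{x. \<bar>g x - f x\<bar> < 1 / (n + 1)}\<close>, and (1) gives (3) through functions equal to 1 off a member of
  the cover. Finite strong covers do not exist, whence the infinitude of \<open>\<gamma>\<close>-covers.\<close>

section \<open>Enlargements inside sets, and the tail condition\<close>

definition strongly_inside :: "'a::metric_space set \<Rightarrow> 'a set \<Rightarrow> bool" where
  "strongly_inside B U \<longleftrightarrow> (\<exists>\<delta>>0. enlargement B \<delta> \<subseteq> U)"

definition gamma_sequence :: "'a::metric_space set set \<Rightarrow> (nat \<Rightarrow> 'a set) \<Rightarrow> bool" where
  "gamma_sequence \<BB> u \<longleftrightarrow> (\<forall>B\<in>\<BB>. \<forall>\<^sub>F n in sequentially. strongly_inside B (u n))"

lemma strongly_inside_subset: "strongly_inside B U \<Longrightarrow> B \<subseteq> U"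
  unfolding strongly_inside_def enlargement_def by force

lemma strongly_inside_mono:
  "strongly_inside B U \<Longrightarrow> A \<subseteq> B \<Longrightarrow> U \<subseteq> V \<Longrightarrow> strongly_inside A V"
  unfolding strongly_inside_def by (meson enlargement_mono order_refl order_trans)

lemma strongly_inside_UNIV: "strongly_inside B UNIV"
  unfolding strongly_inside_def by (auto intro: exI[of _ 1])

lemma strongly_inside_Int:
  assumes "strongly_inside B U" "strongly_inside B V"
  shows "strongly_inside B (U \<inter> V)"
proof -
  obtain d e where "d > 0" "e > 0" "enlargement B d \<subseteq> U" "enlargement B e \<subseteq> V"
    using assms unfolding strongly_inside_def by blast
  then have "enlargement B (min d e) \<subseteq> U \<inter> V" "min d e > 0"
    using enlargement_mono[of B B "min d e" d] enlargement_mono[of B B "min d e" e] by auto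
  then show ?thesis unfolding strongly_inside_def by blast
qed

lemma strongly_inside_INT:
  assumes "finite I" "\<And>i. i \<in> I \<Longrightarrow> strongly_inside B (V i)"
  shows "strongly_inside B (\<Inter>i\<in>I. V i)"
  using assms by (induction I rule: finite_induct) (auto intro: strongly_inside_UNIV strongly_inside_Int)

section \<open>Strong covers and gamma-covers of a bornology\<close>

lemma bornology_finite:
  assumes "bornology \<BB>" "finite F" "F \<noteq> {}"
  shows "F \<in> \<BB>"
proof -
  have "{x} \<in> \<BB>" for x
  proof -
    obtain B where "B \<in> \<BB>" "x \<in> B" using assms(1) unfolding bornology_def by blast
    then show ?thesis using assms(1) unfolding bornology_def by blast
  qed
  then have "finite ((\<lambda>x. {x}) ` F)" "(\<lambda>x. {x}) ` F \<noteq> {}" "(\<lambda>x. {x}) ` F \<subseteq> \<BB>"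
    using assms by auto
  then have "\<Union>((\<lambda>x. {x}) ` F) \<in> \<BB>"
    using assms(1) unfolding bornology_def by blast
  then show ?thesis by simp
qed

text \<open>Singletons lie in the bornology, so the enlargement condition applied to them yields
  \<open>\<Union>\<U> = UNIV\<close>.\<close>

lemma strong_cover_iff:
  assumes "bornology \<BB>"
  shows "strong_cover \<BB> \<U> \<longleftrightarrow>
    (\<forall>U\<in>\<U>. open U) \<and> UNIV \<notin> \<U> \<and> (\<forall>B\<in>\<BB>. \<exists>U\<in>\<U>. strongly_inside B U)"
proof -
  have "\<Union>\<U> = UNIV" if *: "\<forall>B\<in>\<BB>. \<exists>U\<in>\<U>. strongly_inside B U"
  proof -
    have "x \<in> \<Union>\<U>" for x
      using * bornology_finite[OF assms, of "{x}"] strongly_inside_subset by fastforce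
    then show ?thesis by blast
  qed
  then show ?thesis
    unfolding strong_cover_def strongly_inside_def[symmetric] by metis
qed

text \<open>Choose a point omitted by each member. Were there finitely many, these points would form
  a set of the bornology, which some member would contain, its own omitted point included.\<close>

lemma strong_cover_infinite:
  assumes "bornology \<BB>" "strong_cover \<BB> \<U>"
  shows "infinite \<U>"
proof
  assume fin: "finite \<U>"
  have "\<forall>U\<in>\<U>. \<exists>x. x \<notin> U" using assms(2) unfolding strong_cover_def by (metis UNIV_eq_I)
  then obtain p where p: "\<And>U. U \<in> \<U> \<Longrightarrow> p U \<notin> U" by metis
  \<comment> \<open>Inserting \<open>undefined\<close> keeps the set nonempty even if
    \<open>\<U>\<close> is empty.\<close>
  have "insert undefined (p ` \<U>) \<in> \<BB>" using fin by (intro bornology_finite assms(1)) auto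
  then obtain U where "U \<in> \<U>" "strongly_inside (insert undefined (p ` \<U>)) U"
    using assms strong_cover_iff by blast
  then show False using p strongly_inside_subset by blast
qed

lemma gamma_cover_imp_sequence:
  assumes "gamma_cover \<BB> \<V>"
  obtains w where "\<V> = range w" "gamma_sequence \<BB> w"
proof -
  obtain w where w: "\<V> = range w"
    "\<forall>B\<in>\<BB>. \<exists>n\<^sub>0. \<exists>\<delta> :: nat \<Rightarrow> real. \<forall>n\<ge>n\<^sub>0. \<delta> n > 0 \<and> enlargement B (\<delta> n) \<subseteq> w n"
    using assms unfolding gamma_cover_def by blast
  then have "gamma_sequence \<BB> w"
    unfolding gamma_sequence_def eventually_sequentially strongly_inside_def by metis
  with w that show ?thesis by blast
qed

text \<open>Open proper subsets satisfying the tail condition form a strong cover; infinitude of the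
  range follows from that.\<close>

lemma gamma_sequence_imp_cover:
  assumes "bornology \<BB>" "gamma_sequence \<BB> u" "\<And>n. open (u n)" "\<And>n. u n \<noteq> UNIV"
  shows "gamma_cover \<BB> (range u)"
proof -
  have "\<exists>n. strongly_inside B (u n)" if "B \<in> \<BB>" for B
    using assms(2) that unfolding gamma_sequence_def eventually_sequentially by blast
  then have "strong_cover \<BB> (range u)"
    using assms(3,4) unfolding strong_cover_iff[OF assms(1)] by (metis rangeE rangeI)
  moreover have "\<exists>n\<^sub>0. \<exists>\<delta> :: nat \<Rightarrow> real. \<forall>n\<ge>n\<^sub>0. \<delta> n > 0 \<and> enlargement B (\<delta> n) \<subseteq> u n"
    if "B \<in> \<BB>" for B
    using assms(2) that
    unfolding gamma_sequence_def eventually_sequentially strongly_inside_def by metis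
  ultimately show ?thesis
    using strong_cover_infinite[OF assms(1)] unfolding gamma_cover_def strong_cover_def by blast
qed

section \<open>The Gerlits-Nagy selection argument\<close>

lemma gamma_subcovers_imp_selection:
  assumes "bornology \<BB>"
    and sub: "\<forall>\<U>\<in>strong_covers \<BB>. \<exists>\<V>\<subseteq>\<U>. \<V> \<in> gamma_covers \<BB>"
    and U: "\<And>n. strong_cover \<BB> (U n)"
  shows "\<exists>u. (\<forall>n. u n \<in> U n) \<and> gamma_sequence \<BB> u"
proof -
  note cover = strong_cover_iff[OF assms(1)]
  have sub': "\<exists>w. range w \<subseteq> \<U> \<and> gamma_sequence \<BB> w" if "strong_cover \<BB> \<U>" for \<U>
    using sub that gamma_cover_imp_sequence unfolding strong_covers_def gamma_covers_def
    by (metis mem_Collect_eq)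
  obtain S where S: "range S \<subseteq> U 0" "gamma_sequence \<BB> S" using sub' U by blast
  have "\<exists>x. x \<notin> S n" for n
    using S(1) U[of 0] unfolding cover by (metis UNIV_eq_I rangeI subsetD)
  then obtain p where p: "\<And>n. p n \<notin> S n" by metis
  \<comment> \<open>The factor \<open>S n\<close> guards the index: every set of index n omits
    \<open>p n\<close>, whatever the \<open>v i\<close> are. Intersecting \<open>v 0\<close>, ...,
    \<open>v n\<close> lets one set stand for members of the first n + 1 covers at once.\<close>
  define \<W> where "\<W> = {S n \<inter> (\<Inter>i\<le>n. v i) |n v. \<forall>i. v i \<in> U i}"
  have "strong_cover \<BB> \<W>"
    unfolding cover
  proof (intro conjI ballI)
    fix W assume "W \<in> \<W>"
    then obtain n v where "W = S n \<inter> (\<Inter>i\<le>n. v i)" "\<forall>i. v i \<in> U i" unfolding \<W>_def by blast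
    moreover have "open (S n)" using S(1) U[of 0] unfolding cover by blast
    moreover have "open (v i)" if "v i \<in> U i" for i using U[of i] that unfolding cover by blast
    ultimately show "open W" by (simp add: open_Int open_INT)
  next
    show "UNIV \<notin> \<W>" using p unfolding \<W>_def by blast
  next
    fix B assume B: "B \<in> \<BB>"
    obtain n where n: "strongly_inside B (S n)"
      using S(2) B unfolding gamma_sequence_def eventually_sequentially by blast
    have "\<exists>V\<in>U i. strongly_inside B V" for i using U[of i] B unfolding cover by blast
    then obtain v where v: "\<And>i. v i \<in> U i" "\<And>i. strongly_inside B (v i)" by metis
    then have "strongly_inside B (S n \<inter> (\<Inter>i\<le>n. v i))"
      using n by (intro strongly_inside_Int strongly_inside_INT) auto
    then show "\<exists>W\<in>\<W>. strongly_inside B W" unfolding \<W>_def using v by blast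
  qed
  then obtain w where w: "range w \<subseteq> \<W>" "gamma_sequence \<BB> w" using sub' by blast
  then have "\<forall>k. \<exists>n v. w k = S n \<inter> (\<Inter>i\<le>n. v i) \<and> (\<forall>i. v i \<in> U i)"
    unfolding \<W>_def by blast
  then obtain n v where nv: "\<And>k. w k = S (n k) \<inter> (\<Inter>i\<le>n k. v k i)" "\<And>k i. v k i \<in> U i"
    by metis
  have "\<exists>k\<ge>i. i \<le> n k" for i
  proof (rule ccontr)
    assume *: "\<not> (\<exists>k\<ge>i. i \<le> n k)"
    \<comment> \<open>From some k on, \<open>w k\<close> contains all of \<open>p 0\<close>, ...,
      \<open>p i\<close>, whereas \<open>w k\<close> lies in \<open>S (n k)\<close> and so omits
      \<open>p (n k)\<close>. Hence \<open>n k\<close> cannot stay below i.\<close>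
    have "p ` {..i} \<in> \<BB>" by (intro bornology_finite assms(1)) auto
    then obtain k0 where k0: "\<And>k. k \<ge> k0 \<Longrightarrow> strongly_inside (p ` {..i}) (w k)"
      using w(2) unfolding gamma_sequence_def eventually_sequentially by blast
    define k where "k = max i k0"
    have "n k < i" using * unfolding k_def by (meson max.cobounded1 not_le)
    then have "p (n k) \<in> p ` {..i}" by simp
    then have "p (n k) \<in> S (n k)"
      using strongly_inside_subset[OF k0[of k]] nv(1)[of k] unfolding k_def by auto
    then show False using p by blast
  qed
  \<comment> \<open>The bound \<open>i \<le> n (\<kappa> i)\<close> provides a factor from the i-th
    cover; \<open>i \<le> \<kappa> i\<close> transfers the tail condition from \<open>w\<close> to
    the selected factors.\<close>
  then obtain \<kappa> where \<kappa>: "\<And>i. i \<le> \<kappa> i" "\<And>i. i \<le> n (\<kappa> i)" by metis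
  have sub_v: "w (\<kappa> i) \<subseteq> v (\<kappa> i) i" for i using nv(1) \<kappa>(2) by auto
  have "gamma_sequence \<BB> (\<lambda>i. v (\<kappa> i) i)"
    unfolding gamma_sequence_def eventually_sequentially
  proof
    fix B assume "B \<in> \<BB>"
    then obtain k0 where "\<And>k. k \<ge> k0 \<Longrightarrow> strongly_inside B (w k)"
      using w(2) unfolding gamma_sequence_def eventually_sequentially by blast
    then show "\<exists>N. \<forall>i\<ge>N. strongly_inside B (v (\<kappa> i) i)"
      using \<kappa>(1) sub_v strongly_inside_mono by (meson order_refl order_trans)
  qed
  then show ?thesis using nv(2) by (intro exI[of _ "\<lambda>i. v (\<kappa> i) i"]) auto
qed

section \<open>Closure and convergence in the strong topology\<close>

lemma closure_of_strong_topology: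
  assumes "bornology \<BB>"
  shows "f \<in> strong_topology \<BB> closure_of A \<longleftrightarrow>
    f \<in> cont_funs \<and> (\<forall>B\<in>\<BB>. \<forall>\<epsilon>>0. \<exists>g\<in>A. g \<in> strong_nbhd B \<epsilon> f)"
proof -
  \<comment> \<open>A basic neighbourhood need not be open, so the point of \<open>A\<close> is
    found in the open set inside it given by \<open>strong_nbhd_local_base\<close>.\<close>
  have "\<exists>g\<in>A. g \<in> strong_nbhd B \<epsilon> f"
    if "f \<in> strong_topology \<BB> closure_of A" "B \<in> \<BB>" "\<epsilon> > 0" for B \<epsilon>
    using that strong_nbhd_local_base[OF assms that(2,3), of f]
    unfolding in_closure_of topspace_strong_topology[OF assms] by blast
  moreover have "f \<in> strong_topology \<BB> closure_of A"
    if "f \<in> cont_funs" "\<forall>B\<in>\<BB>. \<forall>\<epsilon>>0. \<exists>g\<in>A. g \<in> strong_nbhd B \<epsilon> f"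
    using that unfolding in_closure_of topspace_strong_topology[OF assms]
      openin_strong_topology[OF assms] by blast
  ultimately show ?thesis
    using in_closure_of topspace_strong_topology[OF assms] by metis
qed

lemma limitin_strong_topology:
  assumes "bornology \<BB>"
  shows "limitin (strong_topology \<BB>) a f F \<longleftrightarrow>
    f \<in> cont_funs \<and> (\<forall>B\<in>\<BB>. \<forall>\<epsilon>>0. \<forall>\<^sub>F n in F. a n \<in> strong_nbhd B \<epsilon> f)"
proof (intro iffI conjI ballI allI impI)
  assume lim: "limitin (strong_topology \<BB>) a f F"
  then show f: "f \<in> cont_funs"
    unfolding limitin_def topspace_strong_topology[OF assms] by blast
  fix B and \<epsilon> :: real assume "B \<in> \<BB>" "\<epsilon> > 0"
  then obtain W where W: "openin (strong_topology \<BB>) W" "f \<in> W" "W \<subseteq> strong_nbhd B \<epsilon> f"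
    using strong_nbhd_local_base[OF assms] f by blast
  then have "\<forall>\<^sub>F n in F. a n \<in> W" using lim unfolding limitin_def by blast
  then show "\<forall>\<^sub>F n in F. a n \<in> strong_nbhd B \<epsilon> f"
    by (rule eventually_mono) (use W in blast)
next
  assume *: "f \<in> cont_funs \<and> (\<forall>B\<in>\<BB>. \<forall>\<epsilon>>0. \<forall>\<^sub>F n in F. a n \<in> strong_nbhd B \<epsilon> f)"
  show "limitin (strong_topology \<BB>) a f F"
    unfolding limitin_def topspace_strong_topology[OF assms]
  proof (intro conjI allI impI)
    show "f \<in> cont_funs" using * by blast
    fix W assume "openin (strong_topology \<BB>) W \<and> f \<in> W"
    then obtain B \<epsilon> where "B \<in> \<BB>" "\<epsilon> > 0" and W: "strong_nbhd B \<epsilon> f \<subseteq> W"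
      unfolding openin_strong_topology[OF assms] by blast
    then have "\<forall>\<^sub>F n in F. a n \<in> strong_nbhd B \<epsilon> f" using * by blast
    then show "\<forall>\<^sub>F n in F. a n \<in> W" by (rule eventually_mono) (use W in blast)
  qed
qed

section \<open>From Frechet-Urysohn to gamma-subcovers\<close>

lemma strongly_inside_bump:
  assumes "strongly_inside B U"
  obtains h :: "'a::metric_space \<Rightarrow> real" where
    "continuous_on UNIV h" "strongly_inside B {x. h x = 0}" "\<And>x. x \<notin> U \<Longrightarrow> h x = 1"
proof (cases "B = {}")
  case True
  \<comment> \<open>As \<open>infdist\<close> to the empty set is 0 by convention, the formula of
    the other case would give the zero function; the constant 1 serves here.\<close>
  have "strongly_inside B {x. (1::real) = 0}"
    using True unfolding strongly_inside_def enlargement_def by (auto intro: exI[of _ 1])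
  then show ?thesis using that[of "\<lambda>_. 1"] by simp
next
  case False
  obtain d where d: "d > 0" "enlargement B d \<subseteq> U"
    using assms unfolding strongly_inside_def by blast
  \<comment> \<open>A truncated distance to \<open>B\<close>: 0 up to distance d/2, which leaves
    room for an enlargement of \<open>B\<close>, and 1 from distance d on.\<close>
  define h where "h x = min 1 (max 0 (2 * infdist x B / d - 1))" for x
  have "continuous_on UNIV h"
    unfolding h_def using d by (intro continuous_intros) auto
  moreover have "h x = 0" if x: "x \<in> enlargement B (d/2)" for x
  proof -
    obtain b where "b \<in> B" "dist x b < d/2"
      using x unfolding enlargement_def by (auto simp: dist_commute)
    then have "infdist x B < d/2" using infdist_le le_less_trans by metis
    then show ?thesis unfolding h_def using d by (simp add: field_simps max_def)
  qed
  then have "strongly_inside B {x. h x = 0}"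
    unfolding strongly_inside_def using d by (intro exI[of _ "d/2"]) auto
  moreover have "h x = 1" if "x \<notin> U" for x
  proof -
    have "d \<le> dist x b" if "b \<in> B" for b
      using d \<open>x \<notin> U\<close> that unfolding enlargement_def by (force simp: dist_commute)
    then have "d \<le> infdist x B"
      unfolding infdist_notempty[OF False] using False by (intro cINF_greatest) auto
    then show ?thesis unfolding h_def using d by (simp add: field_simps min_def)
  qed
  ultimately show ?thesis by (rule that)
qed

lemma Frechet_Urysohn_imp_gamma_subcovers:
  assumes "bornology \<BB>" and FU: "Frechet_Urysohn (strong_topology \<BB>)"
    and U: "strong_cover \<BB> \<U>"
  shows "\<exists>\<V>\<subseteq>\<U>. gamma_cover \<BB> \<V>"
proof -
  \<comment> \<open>The cover is coded by functions. Bumps put 0 in the closure of \<open>A\<close>,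
    and each element of a sequence in \<open>A\<close> converging to 0 points back to a member of
    the cover.\<close>
  define A where "A = {h \<in> cont_funs. \<exists>U\<in>\<U>. \<forall>x. x \<notin> U \<longrightarrow> h x = 1}"
  have "\<exists>g\<in>A. g \<in> strong_nbhd B \<epsilon> (\<lambda>_. 0)" if B: "B \<in> \<BB>" and "\<epsilon> > 0" for B \<epsilon>
  proof -
    obtain V where V: "V \<in> \<U>" "strongly_inside B V"
      using U B unfolding strong_cover_iff[OF assms(1)] by blast
    obtain h :: "'a \<Rightarrow> real" where h: "continuous_on UNIV h" "strongly_inside B {x. h x = 0}"
      "\<And>x. x \<notin> V \<Longrightarrow> h x = 1"
      using strongly_inside_bump[OF V(2)] by blast
    have "h \<in> A" using h V unfolding A_def cont_funs_def by auto
    moreover have "h \<in> strong_nbhd B \<epsilon> (\<lambda>_. 0)"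
      using h \<open>\<epsilon> > 0\<close> unfolding strong_nbhd_def cont_funs_def strongly_inside_def by fastforce
    ultimately show ?thesis by blast
  qed
  moreover have "(\<lambda>_. 0) \<in> cont_funs" unfolding cont_funs_def by simp
  ultimately have "(\<lambda>_. 0) \<in> strong_topology \<BB> closure_of A"
    unfolding closure_of_strong_topology[OF assms(1)] by blast
  moreover have "A \<subseteq> topspace (strong_topology \<BB>)"
    unfolding topspace_strong_topology[OF assms(1)] A_def by blast
  ultimately obtain a where a: "range a \<subseteq> A" "limitin (strong_topology \<BB>) a (\<lambda>_. 0) sequentially"
    using FU unfolding Frechet_Urysohn_def by blast
  then have "\<forall>n. \<exists>V\<in>\<U>. \<forall>x. x \<notin> V \<longrightarrow> a n x = 1" unfolding A_def by blast
  then obtain u where u: "\<And>n. u n \<in> \<U>" "\<And>n x. x \<notin> u n \<Longrightarrow> a n x = 1" by metis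
  \<comment> \<open>Off \<open>u n\<close> the value of \<open>a n\<close> is exactly 1, so any
    point where it is less than 1 in modulus lies in \<open>u n\<close>.\<close>
  have inside: "strongly_inside B (u n)" if "a n \<in> strong_nbhd B 1 (\<lambda>_. 0)" for n B
    using that u(2)[of _ n] unfolding strong_nbhd_def strongly_inside_def by fastforce
  have near: "\<forall>\<^sub>F n in sequentially. a n \<in> strong_nbhd B 1 (\<lambda>_. 0)" if "B \<in> \<BB>" for B
    using a(2) that unfolding limitin_strong_topology[OF assms(1)] by simp
  have "gamma_sequence \<BB> u"
    unfolding gamma_sequence_def
  proof
    fix B assume "B \<in> \<BB>"
    from near[OF this] show "\<forall>\<^sub>F n in sequentially. strongly_inside B (u n)"
      by (rule eventually_mono) (rule inside)
  qed
  then have "gamma_cover \<BB> (range u)"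
    using u(1) U unfolding strong_cover_def
    by (intro gamma_sequence_imp_cover assms(1)) metis+
  then show ?thesis using u(1) by blast
qed

section \<open>From selection to the strict Frechet-Urysohn property\<close>

lemma selection_imp_strictly_Frechet_Urysohn:
  assumes "bornology \<BB>"
    and sel: "\<And>U :: nat \<Rightarrow> 'a::metric_space set set.
      (\<And>n. strong_cover \<BB> (U n)) \<Longrightarrow> \<exists>u. (\<forall>n. u n \<in> U n) \<and> gamma_sequence \<BB> u"
  shows "strictly_Frechet_Urysohn (strong_topology \<BB>)"
  unfolding strictly_Frechet_Urysohn_def S1_seq_def
proof (intro ballI allI impI)
  fix f and A :: "nat \<Rightarrow> ('a \<Rightarrow> real) set"
  assume f: "f \<in> topspace (strong_topology \<BB>)"
    and A: "\<forall>n. A n \<in> Omega_at (strong_topology \<BB>) f"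
  have fc: "f \<in> cont_funs" using f topspace_strong_topology[OF assms(1)] by simp
  have A_cont: "A n \<subseteq> cont_funs" for n
    using A topspace_strong_topology[OF assms(1)] unfolding Omega_at_def by blast
  \<comment> \<open>The tolerance tends to 0, so lying inside \<open>P n g\<close> for late n gives
    any required closeness; the summand 1 covers n = 0.\<close>
  define P where "P n g = {x. \<bar>g x - f x\<bar> < 1 / (real n + 1)}" for n and g :: "'a \<Rightarrow> real"
  define V where "V n = P n ` A n" for n
  have open_P: "open (P n g)" if "g \<in> cont_funs" for n g
    using that fc unfolding P_def cont_funs_def by (intro open_Collect_less continuous_intros) auto
  have V_cover: "strong_cover \<BB> (V n)" if "UNIV \<notin> V n" for n
    unfolding strong_cover_iff[OF assms(1)]
  proof (intro conjI ballI that)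
    show "open W" if "W \<in> V n" for W using that A_cont open_P unfolding V_def by blast
    fix B assume "B \<in> \<BB>"
    moreover have "f \<in> strong_topology \<BB> closure_of A n" using A unfolding Omega_at_def by blast
    moreover have "1 / (real n + 1) > 0" by simp
    ultimately obtain g where "g \<in> A n" "g \<in> strong_nbhd B (1 / (real n + 1)) f"
      unfolding closure_of_strong_topology[OF assms(1)] by blast
    then obtain d where "g \<in> A n" "d > 0" "enlargement B d \<subseteq> P n g"
      unfolding strong_nbhd_def P_def by blast
    then show "\<exists>W\<in>V n. strongly_inside B W"
      unfolding V_def strongly_inside_def by blast
  qed
  have "\<exists>u. (\<forall>n. u n \<in> V n) \<and> gamma_sequence \<BB> u"
  \<comment> \<open>If some \<open>g\<close> in \<open>A n\<close> is within the tolerance of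
    \<open>f\<close> everywhere, then \<open>UNIV \<in> V n\<close>. Selecting \<open>UNIV\<close>
    at such n respects the tail condition.\<close>
  proof (cases "\<forall>n. UNIV \<in> V n")
    case True
    then show ?thesis
      by (intro exI[of _ "\<lambda>_. UNIV"]) (auto simp: gamma_sequence_def strongly_inside_UNIV)
  next
    case False
    then obtain m where m: "UNIV \<notin> V m" by blast
    \<comment> \<open>Where \<open>V n\<close> contains \<open>UNIV\<close>, and so is no strong cover, any strong cover may replace it.\<close>
    define V' where "V' n = (if UNIV \<in> V n then V m else V n)" for n
    have "strong_cover \<BB> (V' n)" for n using m V_cover unfolding V'_def by auto
    then obtain u where u: "\<forall>n. u n \<in> V' n" "gamma_sequence \<BB> u" using sel by blast
    define u' where "u' n = (if UNIV \<in> V n then UNIV else u n)" for n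
    have "u' n \<in> V n" for n using spec[OF u(1), of n] unfolding u'_def V'_def by (simp split: if_splits)
    moreover have "gamma_sequence \<BB> u'"
      unfolding gamma_sequence_def
    proof
      fix B assume "B \<in> \<BB>"
      then have "\<forall>\<^sub>F n in sequentially. strongly_inside B (u n)"
        using u(2) unfolding gamma_sequence_def by blast
      then show "\<forall>\<^sub>F n in sequentially. strongly_inside B (u' n)"
        by (rule eventually_mono) (simp add: u'_def strongly_inside_UNIV)
    qed
    ultimately show ?thesis by blast
  qed
  then obtain u where u: "\<And>n. u n \<in> V n" "gamma_sequence \<BB> u" by blast
  then have "\<forall>n. \<exists>g\<in>A n. u n = P n g" unfolding V_def by blast
  then obtain a where a: "\<And>n. a n \<in> A n" "\<And>n. u n = P n (a n)" by metis
  have "\<forall>\<^sub>F n in sequentially. a n \<in> strong_nbhd B \<epsilon> f" if "B \<in> \<BB>" "\<epsilon> > 0" for B \<epsilon>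
  proof -
    have "\<forall>\<^sub>F n in sequentially. strongly_inside B (u n)"
      using u(2) that unfolding gamma_sequence_def by blast
    moreover have "\<forall>\<^sub>F n in sequentially. 1 / (real n + 1) < \<epsilon>"
      using order_tendstoD(2)[OF LIMSEQ_inverse_real_of_nat that(2)]
      by (simp add: inverse_eq_divide add.commute)
    ultimately show ?thesis
    proof eventually_elim
      case (elim n)
      \<comment> \<open>The radius d may vary with n, since \<open>strong_nbhd\<close> quantifies it
        separately for each function.\<close>
      obtain d where d: "d > 0" "enlargement B d \<subseteq> P n (a n)"
        using elim(1) a(2) unfolding strongly_inside_def by metis
      have "\<bar>a n x - f x\<bar> < \<epsilon>" if "x \<in> enlargement B d" for x
        using subsetD[OF d(2) that] elim(2) unfolding P_def by simp
      then show ?case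
        using d(1) a(1) A_cont unfolding strong_nbhd_def by blast
    qed
  qed
  then have "limitin (strong_topology \<BB>) a f sequentially"
    unfolding limitin_strong_topology[OF assms(1)] using fc by blast
  then show "\<exists>a. (\<forall>n. a n \<in> A n) \<and> a \<in> Sigma_at (strong_topology \<BB>) f"
    using a(1) A_cont unfolding Sigma_at_def topspace_strong_topology[OF assms(1)] by blast
qed

section \<open>Equivalence of the four properties\<close>

lemma strictly_Frechet_Urysohn_imp_Frechet_Urysohn:
  assumes "strictly_Frechet_Urysohn Z"
  shows "Frechet_Urysohn Z"
  unfolding Frechet_Urysohn_def
proof (intro allI impI ballI)
  fix A z assume A: "A \<subseteq> topspace Z" and z: "z \<in> Z closure_of A"
  have zt: "z \<in> topspace Z" using z by (simp add: in_closure_of)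
  show "\<exists>a :: nat \<Rightarrow> _. range a \<subseteq> A \<and> limitin Z a z sequentially"
  \<comment> \<open>\<open>Omega_at\<close> only admits sets missing z. If z is in \<open>A\<close>,
    a constant sequence converges; otherwise selection is applied to \<open>A\<close>
    repeated.\<close>
  proof (cases "z \<in> A")
    case True
    then show ?thesis using zt by (intro exI[of _ "\<lambda>_. z"]) auto
  next
    case False
    then have "A \<in> Omega_at Z z" using A z unfolding Omega_at_def by blast
    moreover have "S1_seq (Omega_at Z z) (Sigma_at Z z)"
      using assms zt unfolding strictly_Frechet_Urysohn_def by blast
    ultimately have "\<exists>a. (\<forall>n. a n \<in> A) \<and> a \<in> Sigma_at Z z"
      unfolding S1_seq_def by (auto dest: spec[of _ "\<lambda>_. A"])
    then obtain a where "\<forall>n. a n \<in> A" "a \<in> Sigma_at Z z" by blast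
    then show ?thesis unfolding Sigma_at_def by blast
  qed
qed

theorem corollary2p9:
  fixes \<BB> :: "'a::metric_space set set"
  assumes "bornology \<BB>"
    and "has_closed_base \<BB>"
    and "UNIV \<notin> \<BB>"
    and "strong_Lindelof \<BB>"
  shows "(Frechet_Urysohn (strong_topology \<BB>) \<longleftrightarrow>
            strictly_Frechet_Urysohn (strong_topology \<BB>)) \<and>
         (strictly_Frechet_Urysohn (strong_topology \<BB>) \<longleftrightarrow>
            (\<forall>\<U>\<in>strong_covers \<BB>. \<exists>\<V>\<subseteq>\<U>. \<V> \<in> gamma_covers \<BB>)) \<and>
         ((\<forall>\<U>\<in>strong_covers \<BB>. \<exists>\<V>\<subseteq>\<U>. \<V> \<in> gamma_covers \<BB>) \<longleftrightarrow>
            S1 (strong_covers \<BB>) (gamma_covers \<BB>))"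
    (is "(?FU \<longleftrightarrow> ?SFU) \<and> (_ \<longleftrightarrow> ?sub) \<and> (_ \<longleftrightarrow> ?S1)")
proof -
  \<comment> \<open>The first three properties are linked in a cycle; the fourth is then tied to the
    third in both directions.\<close>
  have "?SFU \<Longrightarrow> ?FU" by (rule strictly_Frechet_Urysohn_imp_Frechet_Urysohn)
  moreover have "?FU \<Longrightarrow> ?sub"
    using Frechet_Urysohn_imp_gamma_subcovers[OF assms(1)]
    unfolding strong_covers_def gamma_covers_def by blast
  moreover have "?sub \<Longrightarrow> ?SFU"
    using gamma_subcovers_imp_selection[OF assms(1)]
    by (intro selection_imp_strictly_Frechet_Urysohn assms(1)) blast
  moreover have ?S1 if sub: ?sub
    unfolding S1_def
  proof (intro allI impI)
    fix U :: "nat \<Rightarrow> 'a set set" assume "\<forall>n. U n \<in> strong_covers \<BB>"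
    then have U: "\<And>n. strong_cover \<BB> (U n)" unfolding strong_covers_def by blast
    obtain u where u: "\<And>n. u n \<in> U n" "gamma_sequence \<BB> u"
      using gamma_subcovers_imp_selection[where U = U, OF assms(1) sub U] by blast
    \<comment> \<open>Members of strong covers are open and differ from \<open>UNIV\<close>, so the
      selected sequence has infinite range.\<close>
    have "gamma_cover \<BB> (range u)"
      using u U unfolding strong_cover_def
      by (intro gamma_sequence_imp_cover assms(1)) metis+
    then show "\<exists>u. (\<forall>n. u n \<in> U n) \<and> range u \<in> gamma_covers \<BB>"
      unfolding gamma_covers_def using u(1) by blast
  qed
  moreover have ?sub if S1: ?S1
  proof
    fix \<U> assume "\<U> \<in> strong_covers \<BB>"
    \<comment> \<open>Selection from the constant sequence \<open>\<U>\<close> yields a gamma-cover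
      inside \<open>\<U>\<close>.\<close>
    then have "\<exists>u :: nat \<Rightarrow> 'a set. (\<forall>n. u n \<in> \<U>) \<and> range u \<in> gamma_covers \<BB>"
      using S1 unfolding S1_def by (auto dest: spec[of _ "\<lambda>_. \<U>"])
    then show "\<exists>\<V>\<subseteq>\<U>. \<V> \<in> gamma_covers \<BB>" by blast
  qed
  ultimately show ?thesis by blast
qed

end
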